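(* Let $X$ be a strongly connected finite digraph with $\delta(X)=0$. Then $\#\mathcal{R}(X)=|m(X)|$, where $\mathcal{R}(X)=\mathcal{BF}_X(\mathbb{Z}V_X)/\mathcal{BF}_X(\mathcal{L}(X))$ and $m(X)=g_X^*(1)/\#\mathrm{BF}(X)_{\rm tors}$.
   Context: Digraph $X=(V_X,E_X)$ with incidence $e\mapsto(o(e),t(e))$; strongly connected means a directed path exists between any two distinct vertices. For finite $X$: $\mathcal{A}_X(v)=\sum_{o(e)=v}t(e)$ on $\mathbb{Z}V_X$, $\mathcal{BF}_X=\mathcal{I}-\mathcal{A}_X$, $\mathrm{BF}(X)=\mathrm{coker}\,\mathcal{BF}_X$, $g_X(u)=\det(\mathcal{I}-\mathcal{A}_Xu)\in\mathbb{Z}[u]$, $r_X=\mathrm{ord}_{u=1}g_X$, $g_X^*(1)$ the coefficient of $(u-1)^{r_X}$ in the Taylor expansion of $g_X$ at $1$, $\delta(X)=r_X-\mathrm{rank}_{\mathbb{Z}}\mathrm{BF}(X)$. When $\delta(X)=0$, $g_X^*(1)$ is a nonzero integer multiple of $\#\mathrm{BF}(X)_{\rm tors}$, and $m(X)$ denotes this integer. $\mathcal{L}(X)=\mathbb{Z}V_X\cap\mathrm{Im}(\mathcal{BF}_{\mathbb{Q}})$ inside $\mathbb{Q}V_X$, where $\mathcal{BF}_{\mathbb{Q}}$ is the extension of $\mathcal{BF}_X$ to $\mathbb{Q}V_X$. *)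

theory Defs
  imports "HOL-Analysis.Analysis" "HOL-Computational_Algebra.Polynomial"
begin

text \<open>A finite digraph X is given by a finite vertex type 'v (V_X = UNIV), a finite
  edge type 'e (E_X = UNIV) and the incidence maps src (=o), tgt (=t) :: 'e => 'v
  (multiple edges and loops allowed).  The free module ZV_X is int^'v, QV_X is rat^'v.\<close>

definition strongly_connected :: "('e::finite \<Rightarrow> 'v::finite) \<Rightarrow> ('e \<Rightarrow> 'v) \<Rightarrow> bool" where
  "strongly_connected src tgt \<longleftrightarrow>
     (\<forall>u w. u \<noteq> w \<longrightarrow> (u, w) \<in> {(src e, tgt e) | e. True}\<^sup>+)"

text \<open>Matrix of A_X w.r.t. the vertex basis: entry (w,v) = number of edges from v to w,
  so that A_X(v) = sum over edges e with o(e)=v of t(e).\<close>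
definition adj :: "('e::finite \<Rightarrow> 'v::finite) \<Rightarrow> ('e \<Rightarrow> 'v) \<Rightarrow> int^'v^'v" where
  "adj src tgt = (\<chi> w v. int (card {e. src e = v \<and> tgt e = w}))"

definition BF_mat :: "('e::finite \<Rightarrow> 'v::finite) \<Rightarrow> ('e \<Rightarrow> 'v) \<Rightarrow> int^'v^'v" where
  "BF_mat src tgt = mat 1 - adj src tgt"

text \<open>BF_X applied to x in ZV_X, and its extension BF_Q to QV_X.\<close>
definition BF :: "('e::finite \<Rightarrow> 'v::finite) \<Rightarrow> ('e \<Rightarrow> 'v) \<Rightarrow> int^'v \<Rightarrow> int^'v" where
  "BF src tgt x = BF_mat src tgt *v x"

definition BF_Q :: "('e::finite \<Rightarrow> 'v::finite) \<Rightarrow> ('e \<Rightarrow> 'v) \<Rightarrow> rat^'v \<Rightarrow> rat^'v" where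
  "BF_Q src tgt y = (\<chi> i j. (of_int (BF_mat src tgt $ i $ j) :: rat)) *v y"

text \<open>g_X(u) = det(I - A_X u) in Z[u].\<close>
definition g_poly :: "('e::finite \<Rightarrow> 'v::finite) \<Rightarrow> ('e \<Rightarrow> 'v) \<Rightarrow> int poly" where
  "g_poly src tgt = det (\<chi> i j. (if i = j then 1 else 0) - [:0, adj src tgt $ i $ j:])"

definition r_X :: "('e::finite \<Rightarrow> 'v::finite) \<Rightarrow> ('e \<Rightarrow> 'v) \<Rightarrow> nat" where
  "r_X src tgt = order 1 (g_poly src tgt)"

text \<open>g_X^*(1): coefficient of (u-1)^{r_X} in the Taylor expansion of g_X at 1,
  i.e. the coefficient of u^{r_X} in g_X(u+1).\<close>
definition g_star :: "('e::finite \<Rightarrow> 'v::finite) \<Rightarrow> ('e \<Rightarrow> 'v) \<Rightarrow> int" where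
  "g_star src tgt = coeff (pcompose (g_poly src tgt) [:1, 1:]) (r_X src tgt)"

text \<open>Cardinality of the quotient group G/H (G, H subgroups of int^'v, H \<subseteq> G):
  number of cosets x + H with x in G.\<close>
definition quot_card :: "(int^'v::finite) set \<Rightarrow> (int^'v) set \<Rightarrow> nat" where
  "quot_card G H = card ((\<lambda>x. (\<lambda>h. x + h) ` H) ` G)"

text \<open>Z-rank of the quotient G/H: maximal size of a family of elements of G whose
  classes are Z-linearly independent in G/H.\<close>
definition quot_independent :: "(int^'v::finite) set \<Rightarrow> (int^'v) set \<Rightarrow> bool" where
  "quot_independent H S \<longleftrightarrow> finite S \<and>
     (\<forall>c :: int^'v \<Rightarrow> int. (\<Sum>s\<in>S. c s *s s) \<in> H \<longrightarrow> (\<forall>s\<in>S. c s = 0))"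

definition quot_rank :: "(int^'v::finite) set \<Rightarrow> (int^'v) set \<Rightarrow> nat" where
  "quot_rank G H = Sup {card S | S. S \<subseteq> G \<and> quot_independent H S}"

text \<open>Torsion subgroup of G/H, represented by its preimage in G.\<close>
definition quot_tors :: "(int^'v::finite) set \<Rightarrow> (int^'v) set \<Rightarrow> (int^'v) set" where
  "quot_tors G H = {x \<in> G. \<exists>k::int. k \<noteq> 0 \<and> k *s x \<in> H}"

text \<open>rank_Z BF(X), #BF(X)_tors, delta(X), m(X).\<close>
definition rank_BF :: "('e::finite \<Rightarrow> 'v::finite) \<Rightarrow> ('e \<Rightarrow> 'v) \<Rightarrow> nat" where
  "rank_BF src tgt = quot_rank UNIV (range (BF src tgt))"

definition tors_BF :: "('e::finite \<Rightarrow> 'v::finite) \<Rightarrow> ('e \<Rightarrow> 'v) \<Rightarrow> nat" where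
  "tors_BF src tgt = quot_card (quot_tors UNIV (range (BF src tgt))) (range (BF src tgt))"

definition delta :: "('e::finite \<Rightarrow> 'v::finite) \<Rightarrow> ('e \<Rightarrow> 'v) \<Rightarrow> int" where
  "delta src tgt = int (r_X src tgt) - int (rank_BF src tgt)"

definition m_X :: "('e::finite \<Rightarrow> 'v::finite) \<Rightarrow> ('e \<Rightarrow> 'v) \<Rightarrow> rat" where
  "m_X src tgt = of_int (g_star src tgt) / of_nat (tors_BF src tgt)"

text \<open>L(X) = ZV_X \<inter> Im(BF_Q) inside QV_X.\<close>
definition L_X :: "('e::finite \<Rightarrow> 'v::finite) \<Rightarrow> ('e \<Rightarrow> 'v) \<Rightarrow> (int^'v) set" where
  "L_X src tgt = {x. \<exists>y. BF_Q src tgt y = (\<chi> i. of_int (x $ i))}"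

text \<open>#R(X) where R(X) = BF_X(ZV_X) / BF_X(L(X)).\<close>
definition card_R :: "('e::finite \<Rightarrow> 'v::finite) \<Rightarrow> ('e \<Rightarrow> 'v) \<Rightarrow> nat" where
  "card_R src tgt = quot_card (range (BF src tgt)) (BF src tgt ` L_X src tgt)"

end

theory Submission
  imports Defs
begin

text \<open>Write \<open>B = I - A\<^sub>X\<close>. Integral row reduction yields a unimodular \<open>V\<close> and a set
  \<open>F\<close> of rows such that the rows \<open>F\<close> of \<open>V B\<close> vanish while over \<open>\<rat>\<close> the other rows
  still reach every vector vanishing on \<open>F\<close>. Then \<open>L(X) = {x. (V x)\<^sub>i = 0 for i \<in> F}\<close>,
  \<open>rank BF(X) = #F\<close>, and the torsion of \<open>BF(X)\<close> is \<open>L(X) / B \<int>V\<^sub>X\<close>.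
  For \<open>M = V B V\<^sup>-\<^sup>1\<close> one has \<open>g\<^sub>X(1 + t) = det (M + t (M - I)) = (-t)\<^bsup>#F\<^esup> q(t)\<close>
  where \<open>q(0) = det M'\<close>, \<open>M'\<close> being \<open>M\<close> with the rows in \<open>F\<close> replaced by unit rows.
  As \<open>\<delta>(X) = 0\<close>, \<open>g\<^sub>X\<close> vanishes at \<open>1\<close> to order exactly \<open>#F\<close>, so \<open>g\<^sub>X\<^sup>*(1) = \<plusminus>det M' \<noteq> 0\<close>.
  On the other side the index \<open>[L(X) : B L(X)]\<close> is \<open>|det M'|\<close>, because the index of a
  nonsingular integer matrix is the absolute value of its determinant, and the tower
  \<open>L(X) \<supseteq> B \<int>V\<^sub>X \<supseteq> B L(X)\<close> splits it as \<open>#BF(X)\<^sub>t\<^sub>o\<^sub>r\<^sub>s \<cdot> #R(X)\<close>.\<close>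

section \<open>Indices of additive subgroups\<close>

definition add_subgroup :: "'a::ab_group_add set \<Rightarrow> bool" where
  "add_subgroup H \<longleftrightarrow> 0 \<in> H \<and> (\<forall>x\<in>H. \<forall>y\<in>H. x - y \<in> H)"

definition cosets :: "'a::ab_group_add set \<Rightarrow> 'a set \<Rightarrow> 'a set set" where
  "cosets G H = (\<lambda>x. (\<lambda>h. x + h) ` H) ` G"

lemma quot_card_eq_card_cosets: "quot_card G H = card (cosets G H)"
  unfolding quot_card_def cosets_def ..

lemma add_subgroupD:
  assumes "add_subgroup H" "x \<in> H" "y \<in> H"
  shows add_subgroup_diff: "x - y \<in> H" and add_subgroup_add: "x + y \<in> H"
  using assms unfolding add_subgroup_def by (metis diff_0 diff_minus_eq_add)+

lemma add_subgroup_minus: "add_subgroup H \<Longrightarrow> x \<in> H \<Longrightarrow> - x \<in> H"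
  unfolding add_subgroup_def by (metis diff_0)

lemma add_subgroup_UNIV: "add_subgroup UNIV"
  unfolding add_subgroup_def by simp

lemma add_subgroup_image:
  assumes "add_subgroup H" "f 0 = 0" "\<And>x y. f (x - y) = f x - f y"
  shows "add_subgroup (f ` H)"
  using assms unfolding add_subgroup_def by (metis image_iff)

lemma coset_eq_iff:
  assumes "add_subgroup H"
  shows "(\<lambda>h. x + h) ` H = (\<lambda>h. y + h) ` H \<longleftrightarrow> x - y \<in> H"
proof
  assume "(\<lambda>h. x + h) ` H = (\<lambda>h. y + h) ` H"
  moreover have "x \<in> (\<lambda>h. x + h) ` H"
    using assms unfolding add_subgroup_def by force
  ultimately obtain h where "h \<in> H" "x = y + h" by auto
  then show "x - y \<in> H" by simp
next
  assume xy: "x - y \<in> H"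
  have "x + h \<in> (\<lambda>h. y + h) ` H" if "h \<in> H" for h
    using add_subgroup_add[OF assms xy that] by (auto simp: image_iff algebra_simps intro: bexI[of _ "x - y + h"])
  moreover have "y + h \<in> (\<lambda>h. x + h) ` H" if "h \<in> H" for h
    using add_subgroup_diff[OF assms that xy] by (auto simp: image_iff algebra_simps intro: bexI[of _ "h - (x - y)"])
  ultimately show "(\<lambda>h. x + h) ` H = (\<lambda>h. y + h) ` H" by blast
qed

lemma card_image_eq_if_same_fibres:
  assumes "\<And>x y. x \<in> A \<Longrightarrow> y \<in> A \<Longrightarrow> f x = f y \<longleftrightarrow> g x = g y"
  shows "card (f ` A) = card (g ` A)"
proof (rule bij_betw_same_card)
  let ?h = "\<lambda>u. g (inv_into A f u)"
  have h: "?h (f x) = g x" if "x \<in> A" for x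
    using assms that by (metis f_inv_into_f imageI inv_into_into)
  show "bij_betw ?h (f ` A) (g ` A)"
  proof (rule bij_betw_imageI)
    show "inj_on ?h (f ` A)"
      using h assms by (auto simp: inj_on_def)
    show "?h ` f ` A = g ` A"
      using h by (auto simp: image_iff)
  qed
qed

lemma card_cosets_eq_card_image:
  assumes "add_subgroup H" "\<And>x y. x \<in> A \<Longrightarrow> y \<in> A \<Longrightarrow> x - y \<in> H \<longleftrightarrow> f x = f y"
  shows "card (cosets A H) = card (f ` A)"
  unfolding cosets_def by (rule card_image_eq_if_same_fibres) (simp add: assms coset_eq_iff)

lemma card_cosets_transfer:
  assumes "add_subgroup H" "add_subgroup H'" "f ` A = A'"
    and "\<And>x y. x \<in> A \<Longrightarrow> y \<in> A \<Longrightarrow> x - y \<in> H \<longleftrightarrow> f x - f y \<in> H'"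
  shows "card (cosets A H) = card (cosets A' H')"
proof -
  have "card (cosets A H) = card ((\<lambda>x. (\<lambda>h. f x + h) ` H') ` A)"
    by (rule card_cosets_eq_card_image) (simp_all add: assms coset_eq_iff)
  also have "\<dots> = card (cosets A' H')"
    unfolding cosets_def assms(3)[symmetric] image_image ..
  finally show ?thesis .
qed

text \<open>With a representative \<open>r x\<close> chosen in each coset \<open>x + G\<close>, the map
  \<open>x + H \<mapsto> (x + G, x - r x + H)\<close> is a bijection \<open>A/H \<rightarrow> A/G \<times> G/H\<close>. No finiteness
  assumption is needed: if one of the indices is infinite, both sides are \<open>0\<close>.\<close>

lemma card_cosets_tower:
  assumes A: "add_subgroup A" and G: "add_subgroup G" and H: "add_subgroup H"
    and "H \<subseteq> G" "G \<subseteq> A"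
  shows "card (cosets A H) = card (cosets A G) * card (cosets G H)"
proof -
  let ?cG = "\<lambda>x. (\<lambda>h. x + h) ` G" and ?cH = "\<lambda>x. (\<lambda>h. x + h) ` H"
  define r where "r x = (SOME a. a \<in> A \<and> ?cG a = ?cG x)" for x
  have r: "r x \<in> A" "?cG (r x) = ?cG x" if "x \<in> A" for x
    using someI[of "\<lambda>a. a \<in> A \<and> ?cG a = ?cG x" x] that unfolding r_def by auto
  have r_cong: "?cG x = ?cG y \<Longrightarrow> r x = r y" for x y
    unfolding r_def by simp
  have r_diff: "x - r x \<in> G" if "x \<in> A" for x
  proof -
    have "r x - x \<in> G"
      using r(2)[OF that] by (simp add: coset_eq_iff[OF G])
    then show ?thesis
      using add_subgroup_minus[OF G] by fastforce
  qed
  define \<phi> where "\<phi> x = (?cG x, ?cH (x - r x))" for x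
  have "card (cosets A H) = card (\<phi> ` A)"
  proof (rule card_cosets_eq_card_image[OF H])
    fix x y assume "x \<in> A" "y \<in> A"
    have "x - y \<in> H \<longleftrightarrow> ?cG x = ?cG y \<and> (x - r x) - (y - r y) \<in> H"
      using \<open>H \<subseteq> G\<close> r_cong[of x y] by (auto simp: coset_eq_iff[OF G])
    then show "x - y \<in> H \<longleftrightarrow> \<phi> x = \<phi> y"
      by (simp add: \<phi>_def coset_eq_iff[OF H])
  qed
  also have "\<phi> ` A = cosets A G \<times> cosets G H"
  proof (intro equalityI subsetI)
    fix c assume "c \<in> \<phi> ` A"
    then show "c \<in> cosets A G \<times> cosets G H"
      using r_diff by (auto simp: \<phi>_def cosets_def)
  next
    fix c assume "c \<in> cosets A G \<times> cosets G H"
    then obtain a g where a: "a \<in> A" and g: "g \<in> G" and c: "c = (?cG a, ?cH g)"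
      by (auto simp: cosets_def)
    define x where "x = r a + g"
    have "x \<in> A"
      using r(1)[OF a] g \<open>G \<subseteq> A\<close> A unfolding x_def by (blast intro: add_subgroup_add)
    have "r a - a \<in> G"
      using r(2)[OF a] by (simp add: coset_eq_iff[OF G])
    then have "(r a - a) + g \<in> G"
      using add_subgroup_add[OF G _ g] by blast
    then have "?cG x = ?cG a"
      by (simp add: coset_eq_iff[OF G] x_def diff_add_eq)
    with \<open>x \<in> A\<close> show "c \<in> \<phi> ` A"
      using r_cong[of x a] by (auto simp: \<phi>_def c x_def image_iff intro!: bexI[of _ x])
  qed
  finally show ?thesis
    by (simp add: card_cartesian_product)
qed

section \<open>Integer matrices\<close>

definition of_int_vec :: "int^'n \<Rightarrow> 'a::ring_1^'n" where
  "of_int_vec x = (\<chi> i. of_int (x $ i))"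

abbreviation rat_matrix :: "int^'n^'m \<Rightarrow> rat^'n^'m" where
  "rat_matrix \<equiv> map_matrix of_int"

lemma of_int_vec_nth [simp]: "of_int_vec x $ i = of_int (x $ i)"
  by (simp add: of_int_vec_def)

lemma of_int_vec_eq_iff [simp]:
  "(of_int_vec x :: 'a::ring_char_0^'n) = of_int_vec y \<longleftrightarrow> x = y"
  by (simp add: vec_eq_iff)

lemma of_int_vec_mult:
  "(of_int_vec (A *v x) :: 'a::comm_ring_1^'m) = map_matrix of_int A *v of_int_vec x"
  by (simp add: vec_eq_iff matrix_vector_mult_def)

lemma map_matrix_of_int_mult:
  "(map_matrix of_int (A ** B) :: 'a::comm_ring_1^'p^'m) = map_matrix of_int A ** map_matrix of_int B"
  by (simp add: vec_eq_iff matrix_matrix_mult_def)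

lemma det_map_matrix:
  fixes h :: "'a::comm_ring_1 \<Rightarrow> 'b::comm_ring_1"
  assumes h1: "h 1 = 1" and hadd: "\<And>x y. h (x + y) = h x + h y" and hmult: "\<And>x y. h (x * y) = h x * h y"
  shows "det (map_matrix h A) = h (det A)"
proof -
  have h0: "h 0 = 0"
    using hadd[of 0 0] by simp
  have hminus: "h (- x) = - h x" for x
    using hadd[of x "- x"] h0 by (simp add: eq_neg_iff_add_eq_0 add.commute)
  have hsum: "h (sum f S) = (\<Sum>x\<in>S. h (f x))" for f :: "_ \<Rightarrow> 'a" and S
    using sum_comp_morphism[of h f S, OF h0 hadd] by (simp add: comp_def)
  have hprod: "h (prod f S) = (\<Prod>x\<in>S. h (f x))" for f :: "_ \<Rightarrow> 'a" and S
    by (induction S rule: infinite_finite_induct) (simp_all add: hmult h1)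
  have hsign: "h (of_int (sign p)) = of_int (sign p)" for p :: "'n \<Rightarrow> 'n"
    by (cases rule: sign_cases[of p]) (simp_all add: h1 hminus)
  show ?thesis
    unfolding det_def hsum hmult hprod hsign by simp
qed

lemma det_map_matrix_of_int:
  "det (map_matrix of_int A :: 'a::comm_ring_1^'n^'n) = of_int (det A)"
  by (rule det_map_matrix) simp_all

lemma abs_det_invertible:
  fixes V :: "int^'n^'n"
  assumes "invertible V"
  shows "\<bar>det V\<bar> = 1"
proof -
  obtain U where "V ** U = mat 1"
    using assms unfolding invertible_def by blast
  then have "det V * det U = 1"
    by (metis det_I det_mul)
  then show ?thesis
    by (auto simp: zmult_eq_1_iff)
qed

lemma inj_matrix_vector_mult_int:
  fixes X :: "int^'n^'n"
  assumes "det X \<noteq> 0"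
  shows "inj ((*v) X)"
proof -
  have "invertible (rat_matrix X)"
    using assms by (simp add: invertible_det_nz det_map_matrix_of_int)
  then have "inj ((*v) (rat_matrix X))"
    by (rule inj_matrix_vector_mult)
  show ?thesis
  proof (rule injI)
    fix x y assume "X *v x = X *v y"
    then have "rat_matrix X *v of_int_vec x = rat_matrix X *v of_int_vec y"
      by (simp flip: of_int_vec_mult)
    then have "(of_int_vec x :: rat^'n) = of_int_vec y"
      using \<open>inj _\<close> by (simp add: inj_eq)
    then show "x = y" by simp
  qed
qed

lemma invertible_mat1: "invertible (mat 1 :: 'a::semiring_1^'n^'n)"
  unfolding invertible_def by (auto intro: exI[of _ "mat 1"])

lemma matrix_add_rdistrib: "(A + B) ** C = A ** C + B ** C"
  by (simp add: matrix_matrix_mult_def vec_eq_iff sum.distrib distrib_right)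

lemma matrix_diff_ldistrib: "(A :: 'a::ring_1^'n^'m) ** (B - C) = A ** B - A ** C"
  by (simp add: matrix_matrix_mult_def vec_eq_iff sum_subtractf right_diff_distrib)

lemma matrix_diff_rdistrib: "(A - B :: 'a::ring_1^'n^'m) ** C = A ** C - B ** C"
  by (simp add: matrix_matrix_mult_def vec_eq_iff sum_subtractf left_diff_distrib)

lemma matrix_vector_mult_scale:
  fixes A :: "'a::comm_semiring_1^'n^'m"
  shows "A *v (c *s x) = c *s (A *v x)"
  by (simp add: vec_eq_iff matrix_vector_mult_def sum_distrib_left mult_ac)

lemma matrix_vector_mult_sum:
  fixes A :: "'a::semiring_1^'n^'m"
  shows "A *v (\<Sum>s\<in>S. f s) = (\<Sum>s\<in>S. A *v f s)"
  by (induction S rule: infinite_finite_induct) (simp_all add: matrix_vector_right_distrib)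

definition identity_outside :: "'n set \<Rightarrow> 'a::zero_neq_one^'n^'n \<Rightarrow> bool" where
  "identity_outside F W \<longleftrightarrow> (\<forall>i k. i \<notin> F \<or> k \<notin> F \<longrightarrow> W $ i $ k = (if i = k then 1 else 0))"

lemma identity_outsideD:
  "identity_outside F W \<Longrightarrow> i \<notin> F \<or> k \<notin> F \<Longrightarrow> W $ i $ k = (if i = k then 1 else 0)"
  unfolding identity_outside_def by blast

lemma identity_outside_mat1: "identity_outside F (mat 1)"
  by (simp add: identity_outside_def mat_def)

lemma identity_outside_mult_row:
  fixes W :: "'a::semiring_1^'n^'n"
  assumes "identity_outside F W" "i \<notin> F"
  shows "(W ** X) $ i = X $ i"
proof -
  have "(W ** X) $ i $ k = (\<Sum>l\<in>UNIV. if l = i then X $ l $ k else 0)" for k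
    unfolding matrix_matrix_mult_def vec_lambda_beta
    by (rule sum.cong) (simp_all add: identity_outsideD[OF assms(1)] assms(2))
  then show ?thesis by (simp add: vec_eq_iff)
qed

lemma identity_outside_mult_zero:
  fixes W :: "'a::semiring_1^'n^'n"
  assumes "identity_outside F W" "i \<in> F" "\<forall>l\<in>F. X $ l $ k = 0"
  shows "(W ** X) $ i $ k = 0"
  unfolding matrix_matrix_mult_def vec_lambda_beta
proof (rule sum.neutral, intro ballI)
  fix l
  show "W $ i $ l * X $ l $ k = 0"
    using assms by (cases "l \<in> F") (auto simp: identity_outsideD)
qed

lemma identity_outside_mult:
  fixes W W' :: "'a::semiring_1^'n^'n"
  assumes "identity_outside F W" "identity_outside F W'"
  shows "identity_outside F (W ** W')"
  unfolding identity_outside_def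
proof (intro allI impI)
  fix i k assume ik: "i \<notin> F \<or> k \<notin> F"
  show "(W ** W') $ i $ k = (if i = k then 1 else 0)"
  proof (cases "i \<in> F")
    case True
    then have "\<forall>l\<in>F. W' $ l $ k = 0"
      using ik identity_outsideD[OF assms(2)] by auto
    then show ?thesis
      using identity_outside_mult_zero[OF assms(1) True] ik True by auto
  next
    case False
    then show ?thesis
      using identity_outside_mult_row[OF assms(1) False, of W'] identity_outsideD[OF assms(2), of i k]
      by simp
  qed
qed

lemma identity_outside_mult_vec:
  fixes W :: "'a::semiring_1^'n^'n"
  assumes "identity_outside F W" "\<forall>i\<in>F. z $ i = 0"
  shows "W *v z = z"
proof -
  have "(W *v z) $ i = (\<Sum>k\<in>UNIV. if k = i then z $ i else 0)" for i
    unfolding matrix_vector_mult_def vec_lambda_beta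
  proof (rule sum.cong)
    fix k
    show "W $ i $ k * z $ k = (if k = i then z $ i else 0)"
      using assms by (cases "k \<in> F"; cases "i \<in> F") (auto simp: identity_outsideD)
  qed simp
  then show ?thesis by (simp add: vec_eq_iff)
qed

definition row_addition :: "'n \<Rightarrow> ('n \<Rightarrow> 'a) \<Rightarrow> 'a::ring_1^'n^'n" where
  "row_addition a r = (\<chi> i k. (if i = k then 1 else 0) + (if i = a then r k else 0))"

lemma row_addition_mult:
  "(row_addition a r ** X) $ i $ k = X $ i $ k + (if i = a then (\<Sum>l\<in>UNIV. r l * X $ l $ k) else 0)"
  by (simp add: row_addition_def matrix_matrix_mult_def distrib_right sum.distrib
      if_distrib[of "\<lambda>u. u * _"] cong: if_cong)

lemma mult_row_addition:
  "(X ** row_addition a r) $ i $ k = X $ i $ k + X $ i $ a * r k"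
  by (simp add: row_addition_def matrix_matrix_mult_def distrib_left sum.distrib
      if_distrib[of "\<lambda>u. _ * u"] cong: if_cong)

lemma invertible_row_addition:
  assumes "r a = 0"
  shows "invertible (row_addition a r)"
proof -
  have "row_addition a r ** row_addition a (\<lambda>k. - r k) = mat 1"
    using assms by (simp add: vec_eq_iff mult_row_addition) (simp add: row_addition_def mat_def)
  moreover have "row_addition a (\<lambda>k. - r k) ** row_addition a r = mat 1"
    using assms by (simp add: vec_eq_iff mult_row_addition) (simp add: row_addition_def mat_def)
  ultimately show ?thesis
    unfolding invertible_def by blast
qed

lemma identity_outside_row_addition:
  assumes "a \<in> F" "\<forall>k. k \<notin> F \<longrightarrow> r k = 0"
  shows "identity_outside F (row_addition a r)"
  using assms by (auto simp: identity_outside_def row_addition_def)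

definition row_swap :: "'n \<Rightarrow> 'n \<Rightarrow> 'a::zero_neq_one^'n^'n" where
  "row_swap p q = (\<chi> i k. if k = (id(p := q, q := p)) i then 1 else 0)"

lemma row_swap_mult:
  fixes X :: "'a::semiring_1^'m^'n"
  shows "(row_swap p q ** X) $ i = X $ (id(p := q, q := p)) i"
  by (simp add: vec_eq_iff row_swap_def matrix_matrix_mult_def if_distrib[of "\<lambda>u. u * _"] cong: if_cong)

lemma invertible_row_swap: "invertible (row_swap p q :: 'a::semiring_1^'n^'n)"
proof -
  have "row_swap p q ** row_swap p q = (mat 1 :: 'a^'n^'n)"
    by (simp add: vec_eq_iff row_swap_mult) (simp add: row_swap_def mat_def)
  then show ?thesis
    unfolding invertible_def by blast
qed

lemma identity_outside_row_swap: "p \<in> F \<Longrightarrow> q \<in> F \<Longrightarrow> identity_outside F (row_swap p q)"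
  by (auto simp: identity_outside_def row_swap_def)

definition dilation :: "'n \<Rightarrow> 'a::zero_neq_one \<Rightarrow> 'a^'n^'n" where
  "dilation a d = (\<chi> i k. if i = k then (if i = a then d else 1) else 0)"

lemma mult_dilation:
  fixes X :: "'a::semiring_1^'n^'m"
  shows "(X ** dilation a d) $ i $ k = X $ i $ k * (if k = a then d else 1)"
  by (simp add: dilation_def matrix_matrix_mult_def if_distrib[of "\<lambda>u. _ * u"] cong: if_cong)

lemma det_dilation: "det (dilation a d :: 'a::comm_ring_1^'n^'n) = d"
proof -
  have "det (dilation a d :: 'a^'n^'n) = (\<Prod>i\<in>UNIV. if i = a then d else 1)"
    by (subst det_diagonal) (simp_all add: dilation_def)
  then show ?thesis by simp
qed

section \<open>The index of an integer matrix\<close>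

definition matrix_index :: "int^'n^'m \<Rightarrow> nat" where
  "matrix_index C = card (cosets UNIV (range ((*v) C)))"

lemma add_subgroup_matrix_image:
  fixes C :: "int^'n^'m"
  shows "add_subgroup H \<Longrightarrow> add_subgroup ((*v) C ` H)"
  by (rule add_subgroup_image) (simp_all add: matrix_vector_mult_diff_distrib)

lemma add_subgroup_matrix_range: "add_subgroup (range ((*v) (C :: int^'n^'m)))"
  by (rule add_subgroup_matrix_image[OF add_subgroup_UNIV])

lemma range_matrix_mult: "range ((*v) (X ** Y)) = (*v) X ` range ((*v) Y)"
  by (auto simp: matrix_vector_mul_assoc[symmetric] image_iff)

lemma matrix_index_mult:
  fixes X Y :: "int^'n^'n"
  assumes "det X \<noteq> 0"
  shows "matrix_index (X ** Y) = matrix_index X * matrix_index Y"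
proof -
  have "card (cosets UNIV (range ((*v) (X ** Y)))) =
      matrix_index X * card (cosets (range ((*v) X)) (range ((*v) (X ** Y))))"
    unfolding matrix_index_def
    by (rule card_cosets_tower[OF add_subgroup_UNIV add_subgroup_matrix_range add_subgroup_matrix_range])
      (auto simp: range_matrix_mult)
  moreover have "card (cosets (range ((*v) X)) (range ((*v) (X ** Y)))) = matrix_index Y"
    unfolding matrix_index_def
  proof (rule sym, rule card_cosets_transfer[OF add_subgroup_matrix_range add_subgroup_matrix_range])
    show "(*v) X ` UNIV = range ((*v) X)" ..
    fix x y :: "int^'n"
    have "X *v x - X *v y \<in> range ((*v) (X ** Y)) \<longleftrightarrow> x - y \<in> range ((*v) Y)"
      using inj_matrix_vector_mult_int[OF assms]
      by (auto simp: range_matrix_mult inj_eq simp flip: matrix_vector_mult_diff_distrib)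
    then show "x - y \<in> range ((*v) Y) \<longleftrightarrow> X *v x - X *v y \<in> range ((*v) (X ** Y))" ..
  qed
  ultimately show ?thesis
    unfolding matrix_index_def by simp
qed

lemma range_invertible:
  assumes "invertible (V :: 'a::semiring_1^'n^'m)"
  shows "range ((*v) V) = UNIV"
proof -
  obtain U where "V ** U = mat 1"
    using assms unfolding invertible_def by blast
  then have "V *v (U *v y) = y" for y
    by (simp add: matrix_vector_mul_assoc)
  then show ?thesis by (metis surj_def)
qed

lemma matrix_index_invertible:
  fixes V :: "int^'n^'n"
  assumes "invertible V"
  shows "matrix_index V = 1"
proof -
  have "cosets (UNIV :: (int^'n) set) UNIV = {UNIV}"
    by (auto simp: cosets_def image_iff intro: exI[of _ "_ - _"])
  then show ?thesis
    by (simp add: matrix_index_def range_invertible[OF assms])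
qed

lemma matrix_index_mult_invertible_left:
  fixes V X :: "int^'n^'n"
  assumes "invertible V"
  shows "matrix_index (V ** X) = matrix_index X"
  using matrix_index_mult[of V X] abs_det_invertible[OF assms] matrix_index_invertible[OF assms]
  by fastforce

lemma matrix_index_mult_invertible_right:
  fixes V X :: "int^'n^'n"
  assumes "invertible V"
  shows "matrix_index (X ** V) = matrix_index X"
  unfolding matrix_index_def range_matrix_mult range_invertible[OF assms] ..

lemma matrix_index_dilation:
  assumes "d \<noteq> 0"
  shows "matrix_index (dilation a d :: int^'n^'n) = nat \<bar>d\<bar>"
proof -
  have "range ((*v) (dilation a d :: int^'n^'n)) = {y. d dvd y $ a}"
  proof (intro equalityI subsetI)
    fix y assume "y \<in> range ((*v) (dilation a d :: int^'n^'n))"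
    then show "y \<in> {y. d dvd y $ a}"
      by (auto simp: matrix_vector_mult_def dilation_def if_distrib[of "\<lambda>u. u * _"] cong: if_cong)
  next
    fix y :: "int^'n" assume "y \<in> {y. d dvd y $ a}"
    then obtain k where "y $ a = d * k" by auto
    then have "dilation a d *v (\<chi> i. if i = a then k else y $ i) = y"
      by (simp add: vec_eq_iff matrix_vector_mult_def dilation_def if_distrib[of "\<lambda>u. u * _"] cong: if_cong)
    then show "y \<in> range ((*v) (dilation a d))" by (metis rangeI)
  qed
  then have "matrix_index (dilation a d :: int^'n^'n) = card ((\<lambda>y::int^'n. y $ a mod \<bar>d\<bar>) ` UNIV)"
    unfolding matrix_index_def
    by (intro card_cosets_eq_card_image add_subgroup_matrix_range) (simp add: mod_eq_dvd_iff)
  also have "(\<lambda>y::int^'n. y $ a mod \<bar>d\<bar>) ` UNIV = {0..<\<bar>d\<bar>}"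
  proof (intro equalityI subsetI)
    fix u assume "u \<in> range (\<lambda>y::int^'n. y $ a mod \<bar>d\<bar>)"
    then show "u \<in> {0..<\<bar>d\<bar>}" using assms by auto
  next
    fix u assume "u \<in> {0..<\<bar>d\<bar>}"
    then have "(\<chi> i. u) $ a mod \<bar>d\<bar> = u" by simp
    then show "u \<in> range (\<lambda>y::int^'n. y $ a mod \<bar>d\<bar>)" by (metis rangeI)
  qed
  finally show ?thesis by simp
qed

lemma row_reduce_column_single_nonzero:
  fixes X :: "int^'m^'n"
  shows "\<exists>W. invertible W \<and> identity_outside F W \<and>
    (\<forall>i\<in>F. \<forall>j\<in>F. (W ** X) $ i $ c \<noteq> 0 \<longrightarrow> (W ** X) $ j $ c \<noteq> 0 \<longrightarrow> i = j)"
proof (induction "\<Sum>i\<in>F. nat \<bar>X $ i $ c\<bar>" arbitrary: X rule: less_induct)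
  case less
  show ?case
  proof (cases "\<exists>p\<in>F. \<exists>q\<in>F. p \<noteq> q \<and> X $ p $ c \<noteq> 0 \<and> X $ q $ c \<noteq> 0 \<and> \<bar>X $ p $ c\<bar> \<le> \<bar>X $ q $ c\<bar>")
    case False
    have "i = j" if "i \<in> F" "j \<in> F" "X $ i $ c \<noteq> 0" "X $ j $ c \<noteq> 0" for i j
      using False that linorder_le_cases[of "\<bar>X $ i $ c\<bar>" "\<bar>X $ j $ c\<bar>"] by blast
    then have "\<forall>i\<in>F. \<forall>j\<in>F. (mat 1 ** X) $ i $ c \<noteq> 0 \<longrightarrow> (mat 1 ** X) $ j $ c \<noteq> 0 \<longrightarrow> i = j"
      by (simp only: matrix_mul_lid) blast
    then show ?thesis
      using invertible_mat1 identity_outside_mat1 by blast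
  next
    case True
    then obtain p q where pq: "p \<in> F" "q \<in> F" "p \<noteq> q" "X $ p $ c \<noteq> 0" "\<bar>X $ p $ c\<bar> \<le> \<bar>X $ q $ c\<bar>"
      by blast
    define E :: "int^'n^'n" where "E = row_addition q (\<lambda>l. if l = p then - (X $ q $ c div X $ p $ c) else 0)"
    have E_col: "(E ** X) $ i $ c = (if i = q then X $ q $ c mod X $ p $ c else X $ i $ c)" for i
      by (simp add: E_def row_addition_mult if_distrib[of "\<lambda>u. u * _"] minus_div_mult_eq_mod[symmetric]
          cong: if_cong)
    have "(\<Sum>i\<in>F. nat \<bar>(E ** X) $ i $ c\<bar>) < (\<Sum>i\<in>F. nat \<bar>X $ i $ c\<bar>)"
    proof (rule sum_strict_mono_ex1)
      have "\<bar>X $ q $ c mod X $ p $ c\<bar> < \<bar>X $ q $ c\<bar>"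
        using abs_mod_less[OF pq(4)] pq(5) by (rule less_le_trans)
      then show "\<forall>i\<in>F. nat \<bar>(E ** X) $ i $ c\<bar> \<le> nat \<bar>X $ i $ c\<bar>"
        and "\<exists>i\<in>F. nat \<bar>(E ** X) $ i $ c\<bar> < nat \<bar>X $ i $ c\<bar>"
        using pq(2) by (auto simp: E_col)
    qed simp
    from less[OF this] obtain W where W: "invertible W" "identity_outside F W"
      "\<forall>i\<in>F. \<forall>j\<in>F. (W ** (E ** X)) $ i $ c \<noteq> 0 \<longrightarrow> (W ** (E ** X)) $ j $ c \<noteq> 0 \<longrightarrow> i = j"
      by blast
    have "invertible (W ** E)"
      using W(1) pq(3) by (simp add: E_def invertible_mult invertible_row_addition)
    moreover have "identity_outside F (W ** E)"
      using W(2) pq(1,2) by (simp add: E_def identity_outside_mult identity_outside_row_addition)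
    ultimately show ?thesis
      using W(3) by (intro exI[of _ "W ** E"]) (simp add: matrix_mul_assoc)
  qed
qed

lemma row_reduce_column:
  fixes X :: "int^'m^'n"
  assumes "p \<in> F"
  shows "\<exists>W. invertible W \<and> identity_outside F W \<and> (\<forall>i\<in>F. i \<noteq> p \<longrightarrow> (W ** X) $ i $ c = 0)"
proof -
  obtain W where W: "invertible W" "identity_outside F W"
    and single: "\<forall>i\<in>F. \<forall>j\<in>F. (W ** X) $ i $ c \<noteq> 0 \<longrightarrow> (W ** X) $ j $ c \<noteq> 0 \<longrightarrow> i = j"
    using row_reduce_column_single_nonzero[of F X c] by blast
  show ?thesis
  proof (cases "\<exists>i\<in>F. i \<noteq> p \<and> (W ** X) $ i $ c \<noteq> 0")
    case False
    then show ?thesis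
      using W by blast
  next
    case True
    then obtain i0 where i0: "i0 \<in> F" "i0 \<noteq> p" "(W ** X) $ i0 $ c \<noteq> 0"
      by blast
    have zero: "(W ** X) $ i $ c = 0" if "i \<in> F" "i \<noteq> i0" for i
      using single[rule_format, OF that(1) i0(1) _ i0(3)] that(2) by blast
    have "(row_swap i0 p ** (W ** X)) $ i $ c = 0" if "i \<in> F" "i \<noteq> p" for i
    proof (cases "i = i0")
      case True
      then show ?thesis
        using zero[of p] i0(2) assms by (simp add: row_swap_mult)
    next
      case False
      then show ?thesis
        using zero[of i] that by (simp add: row_swap_mult)
    qed
    moreover have "invertible (row_swap i0 p ** W)"
      using W(1) by (simp add: invertible_mult invertible_row_swap)
    moreover have "identity_outside F (row_swap i0 p ** W)"
      using W(2) i0(1) assms by (simp add: identity_outside_mult identity_outside_row_swap)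
    ultimately show ?thesis
      by (intro exI[of _ "row_swap i0 p ** W"]) (simp add: matrix_mul_assoc)
  qed
qed

lemma factor_pivot_column:
  fixes Y :: "'a::comm_ring_1^'n^'n"
  assumes "\<And>i. Y $ i $ a = (if i = a then d else 0)"
  shows "Y = (\<chi> i k. if i = a \<or> k = a then (if i = k then 1 else 0) else Y $ i $ k)
    ** row_addition a (\<lambda>k. if k = a then 0 else Y $ a $ k) ** dilation a d"
  using assms by (simp add: vec_eq_iff mult_dilation mult_row_addition)

lemma matrix_index_peel_pivot:
  fixes C :: "int^'n^'n"
  assumes "identity_outside (insert a I) C" "det C \<noteq> 0"
  obtains C1 d where "identity_outside I C1" "det C1 \<noteq> 0" "d \<noteq> 0"
    "\<bar>det C\<bar> = \<bar>det C1\<bar> * \<bar>d\<bar>" "matrix_index C = matrix_index C1 * nat \<bar>d\<bar>"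
proof -
  obtain W where W: "invertible W" "identity_outside (insert a I) W"
    and pivot: "\<forall>i\<in>insert a I. i \<noteq> a \<longrightarrow> (W ** C) $ i $ a = 0"
    using row_reduce_column[of a "insert a I" C a] by blast
  define Y where "Y = W ** C"
  have Y_outside: "identity_outside (insert a I) Y"
    unfolding Y_def using W(2) assms(1) by (rule identity_outside_mult)
  define d where "d = Y $ a $ a"
  have Y_col: "Y $ i $ a = (if i = a then d else 0)" for i
    using pivot identity_outsideD[OF Y_outside, of i a] by (auto simp: Y_def d_def)
  define C1 :: "int^'n^'n" where "C1 = (\<chi> i k. if i = a \<or> k = a then (if i = k then 1 else 0) else Y $ i $ k)"
  define T :: "int^'n^'n" where "T = row_addition a (\<lambda>k. if k = a then 0 else Y $ a $ k)"
  have Y_eq: "Y = C1 ** T ** dilation a d"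
    unfolding C1_def T_def using Y_col by (rule factor_pivot_column)
  have T: "invertible T"
    unfolding T_def by (rule invertible_row_addition) simp
  have "det W * det C = det C1 * det T * d"
    using arg_cong[OF Y_eq, of det] by (simp add: Y_def det_mul det_dilation)
  then have "\<bar>det W\<bar> * \<bar>det C\<bar> = \<bar>det C1\<bar> * \<bar>det T\<bar> * \<bar>d\<bar>"
    by (metis abs_mult)
  then have det_C: "\<bar>det C\<bar> = \<bar>det C1\<bar> * \<bar>d\<bar>"
    using abs_det_invertible[OF W(1)] abs_det_invertible[OF T] by simp
  then have "det C1 \<noteq> 0" "d \<noteq> 0"
    using assms(2) by auto
  moreover have "identity_outside I C1"
    using Y_outside by (auto simp: identity_outside_def C1_def)
  moreover have "matrix_index C = matrix_index C1 * nat \<bar>d\<bar>"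
  proof -
    have "matrix_index C = matrix_index Y"
      unfolding Y_def by (rule matrix_index_mult_invertible_left[OF W(1), symmetric])
    also have "\<dots> = matrix_index (C1 ** T) * matrix_index (dilation a d :: int^'n^'n)"
      unfolding Y_eq using \<open>det C1 \<noteq> 0\<close> abs_det_invertible[OF T]
      by (intro matrix_index_mult) (auto simp: det_mul)
    also have "\<dots> = matrix_index C1 * nat \<bar>d\<bar>"
      using matrix_index_mult_invertible_right[OF T] matrix_index_dilation[OF \<open>d \<noteq> 0\<close>, where 'n='n]
      by simp
    finally show ?thesis .
  qed
  ultimately show ?thesis
    using that det_C by blast
qed

lemma matrix_index_identity_outside:
  fixes C :: "int^'n^'n"
  assumes "identity_outside I C" "det C \<noteq> 0"
  shows "matrix_index C = nat \<bar>det C\<bar>"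
proof -
  have "finite I" by simp
  then show ?thesis
    using assms
  proof (induction I arbitrary: C rule: finite_induct)
    case empty
    then have "C = mat 1"
      by (simp add: vec_eq_iff mat_def identity_outside_def)
    then show ?case
      by (simp add: matrix_index_invertible invertible_mat1)
  next
    case (insert a I)
    obtain C1 d where "identity_outside I C1" "det C1 \<noteq> 0"
      "\<bar>det C\<bar> = \<bar>det C1\<bar> * \<bar>d\<bar>" "matrix_index C = matrix_index C1 * nat \<bar>d\<bar>"
      using matrix_index_peel_pivot[OF insert.prems] by blast
    with insert.IH show ?case
      by (simp add: nat_mult_distrib)
  qed
qed

theorem matrix_index_eq_abs_det:
  fixes C :: "int^'n^'n"
  assumes "det C \<noteq> 0"
  shows "matrix_index C = nat \<bar>det C\<bar>"
  using matrix_index_identity_outside[of UNIV C] assms by (simp add: identity_outside_def)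

section \<open>Saturation of the image lattice\<close>

definition saturation :: "int^'n^'m \<Rightarrow> (int^'m) set" where
  "saturation B = {x. \<exists>y. rat_matrix B *v y = of_int_vec x}"

lemma common_denominator:
  fixes a :: "'a \<Rightarrow> rat"
  assumes "finite S"
  shows "\<exists>(k::int) c. k > 0 \<and> (\<forall>s\<in>S. of_int (c s) = of_int k * a s)"
proof -
  define q where "q s = quotient_of (a s)" for s
  define k where "k = (\<Prod>s\<in>S. snd (q s))"
  have pos: "snd (q s) > 0" for s
    unfolding q_def by (rule quotient_of_denom_pos')
  have a: "a s = of_int (fst (q s)) / of_int (snd (q s))" for s
    unfolding q_def by (rule quotient_of_div) simp
  have "of_int (fst (q s) * (\<Prod>j\<in>S - {s}. snd (q j))) = of_int k * a s" if "s \<in> S" for s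
  proof -
    have "k = snd (q s) * (\<Prod>j\<in>S - {s}. snd (q j))"
      unfolding k_def using assms that by (simp add: prod.remove)
    then show ?thesis
      using pos[of s] by (simp add: a field_simps)
  qed
  moreover have "k > 0"
    unfolding k_def using pos by (simp add: prod_pos)
  ultimately show ?thesis
    by (intro exI[of _ k] exI[of _ "\<lambda>s. fst (q s) * (\<Prod>j\<in>S - {s}. snd (q j))"]) auto
qed

lemma saturation_eq_quot_tors: "quot_tors UNIV (range ((*v) B)) = saturation B"
proof (intro equalityI subsetI)
  fix x assume "x \<in> quot_tors UNIV (range ((*v) B))"
  then obtain k z where k: "k \<noteq> 0" "k *s x = B *v z"
    unfolding quot_tors_def by auto
  have "map_matrix of_int B *v ((1 / of_int k) *s of_int_vec z) = (1 / of_int k) *s (of_int_vec (B *v z) :: rat^_)"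
    by (simp add: of_int_vec_mult vector_scalar_commute)
  also have "\<dots> = (of_int_vec x :: rat^_)"
    using k by (simp add: vec_eq_iff flip: k(2))
  finally show "x \<in> saturation B"
    unfolding saturation_def by blast
next
  fix x assume "x \<in> saturation B"
  then obtain y :: "rat^_" where y: "map_matrix of_int B *v y = of_int_vec x"
    unfolding saturation_def by blast
  obtain k c where k: "k > 0" "\<forall>i\<in>UNIV. of_int (c i) = of_int k * y $ i"
    using common_denominator[of UNIV "\<lambda>i. y $ i"] by auto
  have "of_int_vec (\<chi> i. c i) = of_int k *s y"
    using k(2) by (simp add: vec_eq_iff)
  then have "(of_int_vec (B *v (\<chi> i. c i)) :: rat^_) = of_int_vec (k *s x)"
    by (simp add: of_int_vec_mult vector_scalar_commute y) (simp add: vec_eq_iff)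
  then have "k *s x \<in> range ((*v) B)"
    by (metis of_int_vec_eq_iff rangeI)
  then show "x \<in> quot_tors UNIV (range ((*v) B))"
    using k(1) unfolding quot_tors_def by (intro CollectI conjI UNIV_I exI[of _ k]) auto
qed

lemma add_subgroup_saturation: "add_subgroup (saturation B)"
  unfolding add_subgroup_def saturation_def
proof (intro conjI ballI CollectI)
  show "\<exists>y. map_matrix of_int B *v y = (of_int_vec 0 :: rat^_)"
    by (intro exI[of _ 0]) (simp add: vec_eq_iff)
next
  fix x x' assume "x \<in> {x. \<exists>y. map_matrix of_int B *v y = (of_int_vec x :: rat^_)}"
    and "x' \<in> {x. \<exists>y. map_matrix of_int B *v y = (of_int_vec x :: rat^_)}"
  then obtain y y' :: "rat^_" where "map_matrix of_int B *v y = of_int_vec x" "map_matrix of_int B *v y' = of_int_vec x'"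
    by blast
  then have "map_matrix of_int B *v (y - y') = (of_int_vec (x - x') :: rat^_)"
    by (simp add: matrix_vector_mult_diff_distrib vec_eq_iff)
  then show "\<exists>y. map_matrix of_int B *v y = (of_int_vec (x - x') :: rat^_)" ..
qed

lemma range_subset_saturation: "range ((*v) B) \<subseteq> saturation B"
  unfolding saturation_def by (auto simp: of_int_vec_mult)

section \<open>Adapted bases\<close>

definition vanishing_on :: "'n set \<Rightarrow> ('a::zero^'n) set" where
  "vanishing_on F = {y. \<forall>i\<in>F. y $ i = 0}"

lemma mem_vanishing_on [simp]: "y \<in> vanishing_on F \<longleftrightarrow> (\<forall>i\<in>F. y $ i = 0)"
  by (simp add: vanishing_on_def)

lemma add_subgroup_vanishing_on: "add_subgroup (vanishing_on F :: ('a::ab_group_add^'n) set)"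
  by (simp add: add_subgroup_def)

definition adapted_on :: "'n set \<Rightarrow> int^'m^'m \<Rightarrow> 'm set \<Rightarrow> int^'n^'m \<Rightarrow> bool" where
  "adapted_on P V F B \<longleftrightarrow> invertible V \<and> (\<forall>i\<in>F. \<forall>c\<in>P. (V ** B) $ i $ c = 0) \<and>
     vanishing_on F \<subseteq> range ((*v) (rat_matrix (V ** B)))"

lemma identity_outside_rat_matrix: "identity_outside F W \<Longrightarrow> identity_outside F (rat_matrix W)"
  by (simp add: identity_outside_def)

lemma range_rat_matrix_mult_identity_outside:
  fixes X :: "int^'n^'m" and W :: "int^'m^'m"
  assumes "identity_outside F W" "vanishing_on F \<subseteq> range ((*v) (rat_matrix X))"
  shows "vanishing_on F \<subseteq> range ((*v) (rat_matrix (W ** X)))"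
proof
  fix z :: "rat^'m" assume z: "z \<in> vanishing_on F"
  then have "z \<in> range ((*v) (rat_matrix X))"
    by (rule subsetD[OF assms(2)])
  then obtain y where "z = rat_matrix X *v y"
    by (rule rangeE)
  then have "rat_matrix (W ** X) *v y = rat_matrix W *v z"
    by (simp add: map_matrix_of_int_mult flip: matrix_vector_mul_assoc)
  also have "\<dots> = z"
    using identity_outside_rat_matrix[OF assms(1)] z by (simp add: identity_outside_mult_vec)
  finally show "z \<in> range ((*v) (rat_matrix (W ** X)))"
    by (metis rangeI)
qed

lemma range_rat_matrix_pivot:
  fixes X :: "int^'n^'m"
  assumes range: "vanishing_on F \<subseteq> range ((*v) (rat_matrix X))"
    and pivot: "X $ p $ c \<noteq> 0" "\<forall>i\<in>F. i \<noteq> p \<longrightarrow> X $ i $ c = 0"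
  shows "vanishing_on (F - {p}) \<subseteq> range ((*v) (rat_matrix X))"
proof
  fix z :: "rat^'m" assume z: "z \<in> vanishing_on (F - {p})"
  define t where "t = z $ p / of_int (X $ p $ c)"
  have t: "of_int (X $ p $ c) * t = z $ p"
    using pivot(1) by (simp add: t_def)
  define y0 :: "rat^'n" where "y0 = (\<chi> k. if k = c then t else 0)"
  have X_y0: "(rat_matrix X *v y0) $ i = of_int (X $ i $ c) * t" for i
    by (simp add: y0_def matrix_vector_mult_def if_distrib[of "\<lambda>u. _ * u"] cong: if_cong)
  have "(z - rat_matrix X *v y0) $ i = 0" if "i \<in> F" for i
  proof (cases "i = p")
    case True
    then show ?thesis
      by (simp add: X_y0 t)
  next
    case False
    then have "X $ i $ c = 0" "z $ i = 0"
      using z pivot(2) that by auto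
    then show ?thesis
      by (simp add: X_y0)
  qed
  then have "z - rat_matrix X *v y0 \<in> range ((*v) (rat_matrix X))"
    by (intro subsetD[OF range]) simp
  then obtain y1 where "z - rat_matrix X *v y0 = rat_matrix X *v y1"
    by (rule rangeE)
  then have "rat_matrix X *v (y0 + y1) = z"
    by (simp add: matrix_vector_right_distrib algebra_simps)
  then show "z \<in> range ((*v) (rat_matrix X))"
    by (metis rangeI)
qed

lemma adapted_on_empty:
  fixes B :: "int^'n^'m"
  shows "adapted_on {} (mat 1) UNIV B"
proof -
  have "vanishing_on UNIV \<subseteq> range ((*v) (rat_matrix (mat 1 ** B)))"
  proof
    fix z :: "rat^'m" assume "z \<in> vanishing_on UNIV"
    then have "z = rat_matrix (mat 1 ** B) *v 0"
      by (simp add: vec_eq_iff)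
    then show "z \<in> range ((*v) (rat_matrix (mat 1 ** B)))"
      by (metis rangeI)
  qed
  then show ?thesis
    unfolding adapted_on_def by (simp add: invertible_mat1)
qed

lemma adapted_on_insert:
  assumes "adapted_on P V F B"
  shows "\<exists>V' F'. adapted_on (insert c P) V' F' B"
proof (cases "F = {}")
  case True
  with assms have "adapted_on (insert c P) V F B"
    unfolding adapted_on_def by simp
  then show ?thesis by blast
next
  case False
  then obtain p where p: "p \<in> F" by blast
  have V: "invertible V" and zero: "\<forall>i\<in>F. \<forall>c\<in>P. (V ** B) $ i $ c = 0"
    and range: "vanishing_on F \<subseteq> range ((*v) (rat_matrix (V ** B)))"
    using assms unfolding adapted_on_def by blast+
  obtain W where W: "invertible W" "identity_outside F W"
    and pivot: "\<forall>i\<in>F. i \<noteq> p \<longrightarrow> (W ** (V ** B)) $ i $ c = 0"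
    using row_reduce_column[OF p, of "V ** B" c] by blast
  define X where "X = W ** (V ** B)"
  have X_eq: "X = (W ** V) ** B"
    by (simp add: X_def matrix_mul_assoc)
  have WV: "invertible (W ** V)"
    using W(1) V by (rule invertible_mult)
  have zero_X: "\<forall>i\<in>F. \<forall>c'\<in>P. X $ i $ c' = 0"
    unfolding X_def using zero by (blast intro: identity_outside_mult_zero[OF W(2)])
  have range_X: "vanishing_on F \<subseteq> range ((*v) (rat_matrix X))"
    unfolding X_def using W(2) range by (rule range_rat_matrix_mult_identity_outside)
  show ?thesis
  proof (cases "X $ p $ c = 0")
    case True
    then have "\<forall>i\<in>F. \<forall>c'\<in>insert c P. X $ i $ c' = 0"
      using pivot zero_X by (auto simp: X_def)
    then have "adapted_on (insert c P) (W ** V) F B"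
      unfolding adapted_on_def X_eq[symmetric] using WV range_X by blast
    then show ?thesis by blast
  next
    case False
    have "\<forall>i\<in>F - {p}. \<forall>c'\<in>insert c P. X $ i $ c' = 0"
      using pivot zero_X by (auto simp: X_def)
    moreover have "vanishing_on (F - {p}) \<subseteq> range ((*v) (rat_matrix X))"
      using range_X False pivot unfolding X_def by (rule range_rat_matrix_pivot)
    ultimately have "adapted_on (insert c P) (W ** V) (F - {p}) B"
      unfolding adapted_on_def X_eq[symmetric] using WV by blast
    then show ?thesis by blast
  qed
qed

lemma exists_adapted_on: "finite P \<Longrightarrow> \<exists>V F. adapted_on P V F B"
proof (induction P rule: finite_induct)
  case empty
  then show ?case
    using adapted_on_empty by blast
next
  case (insert c P)
  then show ?case
    using adapted_on_insert by blast
qed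

lemma saturation_eq_if_adapted:
  assumes "adapted_on UNIV V F B"
  shows "saturation B = {x. V *v x \<in> vanishing_on F}"
proof -
  have V: "invertible V" and zero: "\<forall>i\<in>F. \<forall>k. (V ** B) $ i $ k = 0"
    and range: "vanishing_on F \<subseteq> range ((*v) (rat_matrix (V ** B)))"
    using assms unfolding adapted_on_def by blast+
  obtain U where U: "U ** V = mat 1"
    using V unfolding invertible_def by blast
  show ?thesis
  proof (intro equalityI subsetI)
    fix x assume "x \<in> saturation B"
    then obtain y where "rat_matrix B *v y = of_int_vec x"
      unfolding saturation_def by blast
    then have y: "rat_matrix (V ** B) *v y = of_int_vec (V *v x)"
      by (simp add: map_matrix_of_int_mult of_int_vec_mult flip: matrix_vector_mul_assoc)
    have "(V *v x) $ i = 0" if "i \<in> F" for i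
    proof -
      have "(rat_matrix (V ** B) *v y) $ i = 0"
        using zero that by (simp add: matrix_vector_mult_def)
      then show ?thesis
        unfolding y by simp
    qed
    then show "x \<in> {x. V *v x \<in> vanishing_on F}"
      by simp
  next
    fix x assume "x \<in> {x. V *v x \<in> vanishing_on F}"
    then have "of_int_vec (V *v x) \<in> range ((*v) (rat_matrix (V ** B)))"
      by (intro subsetD[OF range]) simp
    then obtain y where "of_int_vec (V *v x) = rat_matrix (V ** B) *v y"
      by (rule rangeE)
    then have "rat_matrix U *v of_int_vec (V *v x) = rat_matrix U *v (rat_matrix (V ** B) *v y)"
      by simp
    then have "of_int_vec x = rat_matrix B *v y"
      by (simp add: map_matrix_of_int_mult matrix_vector_mul_assoc matrix_mul_assoc U
          flip: of_int_vec_mult map_matrix_of_int_mult)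
    then show "x \<in> saturation B"
      unfolding saturation_def by auto
  qed
qed

lemma exists_adapted_basis:
  fixes B :: "int^'n^'m"
  obtains V :: "int^'m^'m" and F where "invertible V" "\<forall>i\<in>F. \<forall>k. (V ** B) $ i $ k = 0"
    "saturation B = {x. V *v x \<in> vanishing_on F}"
proof -
  obtain V :: "int^'m^'m" and F where adapted: "adapted_on UNIV V F B"
    using exists_adapted_on[OF finite[of UNIV]] by blast
  show ?thesis
  proof (rule that)
    show "invertible V" "\<forall>i\<in>F. \<forall>k. (V ** B) $ i $ k = 0"
      using adapted unfolding adapted_on_def by blast+
    show "saturation B = {x. V *v x \<in> vanishing_on F}"
      using adapted by (rule saturation_eq_if_adapted)
  qed
qed

section \<open>The rank of \<open>BF(X)\<close>\<close>

lemma vec_family_dependent: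
  fixes w :: "'a \<Rightarrow> 'b::field^'n"
  assumes "finite S" "vec.dim (w ` S) < card S"
  shows "\<exists>a. (\<Sum>s\<in>S. a s *s w s) = 0 \<and> (\<exists>s\<in>S. a s \<noteq> 0)"
proof (cases "inj_on w S")
  case False
  then obtain s t where st: "s \<in> S" "t \<in> S" "s \<noteq> t" "w s = w t"
    unfolding inj_on_def by blast
  let ?a = "\<lambda>u. if u = s then 1 else if u = t then -1 else 0"
  have "(\<Sum>u\<in>S. ?a u *s w u) = (\<Sum>u\<in>{s, t}. ?a u *s w u)"
    using assms(1) st by (intro sum.mono_neutral_right) auto
  also have "\<dots> = 0"
    using st by simp
  finally show ?thesis
    using st(1) by (intro exI[of _ ?a]) auto
next
  case True
  then have "card (w ` S) > vec.dim (w ` S)"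
    using assms by (simp add: card_image)
  then have "vec.dependent (w ` S)"
    using vec.dependent_biggerset_general by blast
  then obtain u where u: "(\<Sum>v\<in>w ` S. u v *s v) = 0" "\<exists>v\<in>w ` S. u v \<noteq> 0"
    using vec.dependent_finite[of "w ` S"] assms(1) by blast
  have "(\<Sum>s\<in>S. u (w s) *s w s) = 0"
    using u(1) by (simp add: sum.reindex[OF True])
  then show ?thesis
    using u(2) by (intro exI[of _ "\<lambda>s. u (w s)"]) auto
qed

lemma in_span_axis:
  fixes x :: "'a::field^'n"
  assumes "\<forall>i. i \<notin> F \<longrightarrow> x $ i = 0"
  shows "x \<in> vec.span ((\<lambda>j. axis j 1) ` F)"
proof -
  have "x = (\<Sum>j\<in>F. x $ j *s axis j 1)"
    using assms by (auto simp: vec_eq_iff axis_def if_distrib[of "\<lambda>u. _ * u"] cong: if_cong)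
  also have "\<dots> \<in> vec.span ((\<lambda>j. axis j 1) ` F)"
    by (intro vec.span_sum vec.span_scale vec.span_base) auto
  finally show ?thesis .
qed

lemma exists_int_relation:
  fixes p :: "'a \<Rightarrow> int^'n"
  assumes "finite S" "card F < card S" "\<forall>s\<in>S. \<forall>i. i \<notin> F \<longrightarrow> p s $ i = 0"
  shows "\<exists>c. (\<Sum>s\<in>S. c s *s p s) = 0 \<and> (\<exists>s\<in>S. c s \<noteq> 0)"
proof -
  let ?w = "\<lambda>s. of_int_vec (p s) :: rat^'n"
  have "?w ` S \<subseteq> vec.span ((\<lambda>j. axis j 1) ` F)"
    using assms(3) by (auto intro!: in_span_axis)
  then have "vec.dim (?w ` S) \<le> card ((\<lambda>j. axis j (1::rat)) ` F)"
    by (rule vec.dim_le_card) simp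
  also have "\<dots> \<le> card F"
    by (rule card_image_le) simp
  finally obtain a where a: "(\<Sum>s\<in>S. a s *s ?w s) = 0" "\<exists>s\<in>S. a s \<noteq> 0"
    using vec_family_dependent[OF assms(1), of ?w] assms(2) by auto
  obtain k c where k: "k > 0" "\<forall>s\<in>S. of_int (c s) = of_int k * a s"
    using common_denominator[OF assms(1), of a] by blast
  have "(of_int_vec (\<Sum>s\<in>S. c s *s p s) :: rat^'n) = of_int k *s (\<Sum>s\<in>S. a s *s ?w s)"
    using k(2) by (simp add: vec_eq_iff sum_distrib_left mult.assoc)
  also have "\<dots> = of_int_vec 0"
    using a(1) by (simp add: vec_eq_iff)
  finally have "(\<Sum>s\<in>S. c s *s p s) = 0"
    by (rule of_int_vec_eq_iff[THEN iffD1])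
  moreover have "\<exists>s\<in>S. c s \<noteq> 0"
  proof -
    obtain s where "s \<in> S" "a s \<noteq> 0"
      using a(2) by blast
    then have "of_int (c s) \<noteq> (0::rat)"
      using k by simp
    then show ?thesis
      using \<open>s \<in> S\<close> by auto
  qed
  ultimately show ?thesis by blast
qed

lemma card_le_of_quot_independent:
  fixes B :: "int^'n^'m" and V :: "int^'m^'m"
  assumes sat: "saturation B = {x. V *v x \<in> vanishing_on F}"
    and ind: "quot_independent (range ((*v) B)) S"
  shows "card S \<le> card F"
proof (rule ccontr)
  assume "\<not> card S \<le> card F"
  moreover have "finite S"
    using ind unfolding quot_independent_def by blast
  moreover define p where "p s = (\<chi> i. if i \<in> F then (V *v s) $ i else 0)" for s
  ultimately obtain c where c: "(\<Sum>s\<in>S. c s *s p s) = 0" "\<exists>s\<in>S. c s \<noteq> 0"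
    using exists_int_relation[of S F p] by (auto simp: p_def)
  define x where "x = (\<Sum>s\<in>S. c s *s s)"
  have "(V *v x) $ i = (\<Sum>s\<in>S. c s *s p s) $ i" if "i \<in> F" for i
    using that by (simp add: x_def p_def matrix_vector_mult_sum matrix_vector_mult_scale)
  then have "x \<in> quot_tors UNIV (range ((*v) B))"
    using c(1) by (simp add: saturation_eq_quot_tors sat)
  then obtain k where k: "k \<noteq> 0" "k *s x \<in> range ((*v) B)"
    unfolding quot_tors_def by blast
  have "k *s x = (\<Sum>s\<in>S. (k * c s) *s s)"
    by (simp add: x_def vec_eq_iff sum_distrib_left mult.assoc)
  have ind_rel: "d s = 0" if "(\<Sum>s\<in>S. d s *s s) \<in> range ((*v) B)" "s \<in> S" for d s
    using ind that unfolding quot_independent_def by blast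
  then have "\<forall>s\<in>S. k * c s = 0"
    using ind_rel[of "\<lambda>s. k * c s"] k(2) \<open>k *s x = _\<close> by simp
  then show False
    using c(2) k(1) by simp
qed

lemma quot_independent_image_axis:
  fixes B :: "int^'n^'m" and V U :: "int^'m^'m"
  assumes VU: "V ** U = mat 1"
    and sat: "saturation B = {x. V *v x \<in> vanishing_on F}"
  shows "quot_independent (range ((*v) B)) ((\<lambda>j. U *v axis j 1) ` F)"
    and "card ((\<lambda>j. U *v axis j 1) ` F) = card F"
proof -
  have VU_axis: "V *v (U *v axis j 1) = axis j 1" for j
    by (simp add: matrix_vector_mul_assoc VU)
  have inj: "inj (\<lambda>j. U *v axis j (1::int))"
    by (rule injI) (metis VU_axis axis_eq_axis one_neq_zero)
  then show "card ((\<lambda>j. U *v axis j 1) ` F) = card F"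
    by (simp add: card_image inj_on_subset)
  show "quot_independent (range ((*v) B)) ((\<lambda>j. U *v axis j 1) ` F)"
    unfolding quot_independent_def
  proof (intro conjI allI impI ballI)
    fix c s
    assume "(\<Sum>s\<in>(\<lambda>j. U *v axis j 1) ` F. c s *s s) \<in> range ((*v) B)" and s: "s \<in> (\<lambda>j. U *v axis j 1) ` F"
    then have "(\<Sum>j\<in>F. c (U *v axis j 1) *s (U *v axis j 1)) \<in> saturation B"
      using range_subset_saturation inj by (auto simp: sum.reindex inj_on_subset)
    then have zero: "(\<Sum>j\<in>F. c (U *v axis j 1) *s axis j 1) $ i = 0" if "i \<in> F" for i
      using that by (simp add: sat matrix_vector_mult_sum matrix_vector_mult_scale VU_axis)
    obtain j where "j \<in> F" "s = U *v axis j 1"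
      using s by blast
    then show "c s = 0"
      using zero[of j] by (simp add: axis_def if_distrib[of "\<lambda>u. _ * u"] cong: if_cong)
  qed simp
qed

lemma quot_rank_eq_card:
  fixes B :: "int^'n^'m" and V :: "int^'m^'m"
  assumes "invertible V" and sat: "saturation B = {x. V *v x \<in> vanishing_on F}"
  shows "quot_rank UNIV (range ((*v) B)) = card F"
proof -
  obtain U where "V ** U = mat 1"
    using assms(1) unfolding invertible_def by blast
  note basis = quot_independent_image_axis[OF this sat]
  have "card F \<in> {card S |S. S \<subseteq> UNIV \<and> quot_independent (range ((*v) B)) S}"
    using basis by (metis (mono_tags, lifting) mem_Collect_eq subset_UNIV)
  moreover have "n \<le> card F" if "n \<in> {card S |S. S \<subseteq> UNIV \<and> quot_independent (range ((*v) B)) S}" for n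
    using that card_le_of_quot_independent[OF sat] by blast
  ultimately show ?thesis
    unfolding quot_rank_def by (rule cSup_eq_maximum)
qed

section \<open>The index of \<open>B L(X)\<close> in \<open>L(X)\<close>\<close>

definition replace_rows :: "'n set \<Rightarrow> 'a::zero_neq_one^'n^'n \<Rightarrow> 'a^'n^'n" where
  "replace_rows F M = (\<chi> i k. if i \<in> F then (if i = k then 1 else 0) else M $ i $ k)"

definition replace_columns :: "'n set \<Rightarrow> 'a::zero_neq_one^'n^'n \<Rightarrow> 'a^'n^'n" where
  "replace_columns F M = (\<chi> i k. if k \<in> F then (if i = k then 1 else 0) else M $ i $ k)"

lemma abs_det_replace_columns:
  fixes M :: "int^'n^'n"
  assumes zero: "\<forall>i\<in>F. \<forall>k. M $ i $ k = 0"
  shows "\<bar>det (replace_columns F M)\<bar> = \<bar>det (replace_rows F M)\<bar>"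
proof -
  define N :: "int^'n^'n" where "N = (\<chi> i l. if l \<in> F then M $ i $ l else 0)"
  have "N ** N = 0"
    using zero by (auto simp: vec_eq_iff matrix_matrix_mult_def N_def intro!: sum.neutral)
  then have "(mat 1 - N) ** (mat 1 + N) = mat 1" "(mat 1 + N) ** (mat 1 - N) = mat 1"
    by (simp_all add: matrix_add_ldistrib matrix_add_rdistrib matrix_diff_ldistrib
        matrix_diff_rdistrib)
  then have "invertible (mat 1 - N)"
    unfolding invertible_def by blast
  moreover have "replace_columns F M = (mat 1 - N) ** replace_rows F M"
  proof -
    have "N $ i $ l * replace_rows F M $ l $ k = (if l = k then (if k \<in> F then M $ i $ k else 0) else 0)"
      for i l k
      by (auto simp: N_def replace_rows_def)
    then have "(N ** replace_rows F M) $ i $ k = (if k \<in> F then M $ i $ k else 0)" for i k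
      by (simp add: matrix_matrix_mult_def)
    then show ?thesis
      using zero by (auto simp: vec_eq_iff matrix_diff_rdistrib replace_columns_def replace_rows_def)
  qed
  ultimately show ?thesis
    by (simp add: det_mul abs_mult abs_det_invertible)
qed

definition clear_coords :: "'n set \<Rightarrow> 'a::zero^'n \<Rightarrow> 'a^'n" where
  "clear_coords F x = (\<chi> i. if i \<in> F then 0 else x $ i)"

lemma
  fixes x y :: "'a::group_add^'n"
  shows clear_coords_add: "clear_coords F (x + y) = clear_coords F x + clear_coords F y"
    and clear_coords_diff: "clear_coords F (x - y) = clear_coords F x - clear_coords F y"
    and clear_coords_self: "clear_coords F (x - clear_coords F x) = 0"
    and clear_coords_vanishing_on: "clear_coords F x \<in> vanishing_on F"
  by (simp_all add: clear_coords_def vec_eq_iff)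

lemma clear_coords_id: "x \<in> vanishing_on F \<Longrightarrow> clear_coords F x = x"
  by (auto simp: clear_coords_def vec_eq_iff)

lemma replace_columns_mult_vec:
  fixes M :: "'a::ring_1^'n^'n"
  shows "replace_columns F M *v a = M *v clear_coords F a + (a - clear_coords F a)"
proof -
  have "(replace_columns F M *v a) $ i =
      (\<Sum>j\<in>UNIV. M $ i $ j * clear_coords F a $ j + (if j = i then (a - clear_coords F a) $ i else 0))" for i
    unfolding replace_columns_def matrix_vector_mult_def vec_lambda_beta
    by (intro sum.cong) (auto simp: clear_coords_def)
  then show ?thesis
    by (simp add: vec_eq_iff sum.distrib matrix_vector_mult_def)
qed

lemma range_replace_columns_iff:
  fixes M :: "int^'n^'n"
  assumes zero: "\<forall>i\<in>F. \<forall>k. M $ i $ k = 0"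
  shows "w \<in> range ((*v) (replace_columns F M)) \<longleftrightarrow> clear_coords F w \<in> (*v) M ` vanishing_on F"
proof
  assume "w \<in> range ((*v) (replace_columns F M))"
  then obtain a where w: "w = M *v clear_coords F a + (a - clear_coords F a)"
    by (auto simp: replace_columns_mult_vec)
  have "M *v clear_coords F a \<in> vanishing_on F"
    using zero by (simp add: matrix_vector_mult_def)
  then have "clear_coords F w = M *v clear_coords F a"
    unfolding w clear_coords_add clear_coords_self by (simp add: clear_coords_id)
  then show "clear_coords F w \<in> (*v) M ` vanishing_on F"
    using clear_coords_vanishing_on by blast
next
  assume "clear_coords F w \<in> (*v) M ` vanishing_on F"
  then obtain l where l: "l \<in> vanishing_on F" "M *v l = clear_coords F w"
    by auto
  have "clear_coords F (l + (w - clear_coords F w)) = l"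
    unfolding clear_coords_add clear_coords_self clear_coords_id[OF l(1)] by simp
  then have "replace_columns F M *v (l + (w - clear_coords F w)) = w"
    using l(2) by (simp add: replace_columns_mult_vec)
  then show "w \<in> range ((*v) (replace_columns F M))"
    by (metis rangeI)
qed

lemma card_cosets_vanishing_on:
  fixes M :: "int^'n^'n"
  assumes zero: "\<forall>i\<in>F. \<forall>k. M $ i $ k = 0"
  shows "card (cosets (vanishing_on F) ((*v) M ` vanishing_on F)) = matrix_index (replace_columns F M)"
  unfolding matrix_index_def
proof (rule sym, rule card_cosets_transfer[where f="clear_coords F"])
  show "add_subgroup (range ((*v) (replace_columns F M)))"
    by (rule add_subgroup_matrix_range)
  show "add_subgroup ((*v) M ` vanishing_on F)"
    by (intro add_subgroup_matrix_image add_subgroup_vanishing_on)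
  show "clear_coords F ` (UNIV :: (int^'n) set) = vanishing_on F"
  proof (intro equalityI subsetI)
    fix y assume "y \<in> vanishing_on F"
    then show "y \<in> range (clear_coords F)"
      by (metis clear_coords_id rangeI)
  qed (blast intro: clear_coords_vanishing_on)
  fix x y :: "int^'n"
  show "x - y \<in> range ((*v) (replace_columns F M)) \<longleftrightarrow>
      clear_coords F x - clear_coords F y \<in> (*v) M ` vanishing_on F"
    by (simp add: range_replace_columns_iff[OF zero] clear_coords_diff)
qed

lemma card_cosets_saturation_conj:
  fixes B V U :: "int^'n^'n"
  assumes VU: "V ** U = mat 1" "U ** V = mat 1"
    and sat: "saturation B = {x. V *v x \<in> vanishing_on F}"
  shows "card (cosets (saturation B) ((*v) B ` saturation B)) =
    card (cosets (vanishing_on F) ((*v) (V ** B ** U) ` vanishing_on F))"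
proof (rule card_cosets_transfer[where f="(*v) V"])
  have VU_vec: "V *v (U *v y) = y" "U *v (V *v y) = y" for y
    by (simp_all add: matrix_vector_mul_assoc VU)
  have sat_U: "U *v y \<in> saturation B" if "y \<in> vanishing_on F" for y
    using that by (simp add: sat VU_vec)
  show "add_subgroup ((*v) B ` saturation B)"
    by (intro add_subgroup_matrix_image add_subgroup_saturation)
  show "add_subgroup ((*v) (V ** B ** U) ` vanishing_on F)"
    by (intro add_subgroup_matrix_image add_subgroup_vanishing_on)
  show "(*v) V ` saturation B = vanishing_on F"
  proof (intro equalityI subsetI)
    fix y :: "int^'n" assume "y \<in> (*v) V ` saturation B"
    then show "y \<in> vanishing_on F"
      by (auto simp: sat)
  next
    fix y :: "int^'n" assume "y \<in> vanishing_on F"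
    then show "y \<in> (*v) V ` saturation B"
      using sat_U VU_vec(1) by (metis image_eqI)
  qed
  fix x y assume "x \<in> saturation B" "y \<in> saturation B"
  show "x - y \<in> (*v) B ` saturation B \<longleftrightarrow> V *v x - V *v y \<in> (*v) (V ** B ** U) ` vanishing_on F"
  proof
    assume "x - y \<in> (*v) B ` saturation B"
    then obtain l where l: "l \<in> saturation B" "x - y = B *v l"
      by blast
    then have "V *v x - V *v y = (V ** B ** U) *v (V *v l)"
      by (simp add: VU_vec flip: matrix_vector_mul_assoc matrix_vector_mult_diff_distrib)
    moreover have "V *v l \<in> vanishing_on F"
      using l(1) by (simp add: sat)
    ultimately show "V *v x - V *v y \<in> (*v) (V ** B ** U) ` vanishing_on F"
      by blast
  next
    assume "V *v x - V *v y \<in> (*v) (V ** B ** U) ` vanishing_on F"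
    then obtain l where l: "l \<in> vanishing_on F" "V *v (x - y) = (V ** B ** U) *v l"
      by (auto simp: matrix_vector_mult_diff_distrib simp del: mem_vanishing_on)
    then have "x - y = B *v (U *v l)"
      by (metis VU_vec(2) matrix_vector_mul_assoc)
    then show "x - y \<in> (*v) B ` saturation B"
      using sat_U[OF l(1)] by blast
  qed
qed

lemma card_cosets_saturation_tower:
  fixes B :: "int^'n^'n"
  shows "card (cosets (saturation B) ((*v) B ` saturation B)) =
    card (cosets (saturation B) (range ((*v) B))) * card (cosets (range ((*v) B)) ((*v) B ` saturation B))"
  by (rule card_cosets_tower)
    (simp_all add: add_subgroup_saturation add_subgroup_matrix_range add_subgroup_matrix_image
      range_subset_saturation image_mono)

lemma card_cosets_saturation_image:
  fixes B V U :: "int^'n^'n"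
  assumes VU: "V ** U = mat 1" "U ** V = mat 1"
    and zero: "\<forall>i\<in>F. \<forall>k. (V ** B) $ i $ k = 0"
    and sat: "saturation B = {x. V *v x \<in> vanishing_on F}"
    and det: "det (replace_rows F (V ** B ** U)) \<noteq> 0"
  shows "card (cosets (saturation B) ((*v) B ` saturation B)) = nat \<bar>det (replace_rows F (V ** B ** U))\<bar>"
proof -
  have M_zero: "\<forall>i\<in>F. \<forall>k. (V ** B ** U) $ i $ k = 0"
    using zero by (simp add: matrix_matrix_mult_def[of "V ** B"])
  note abs_det = abs_det_replace_columns[OF M_zero]
  have "card (cosets (saturation B) ((*v) B ` saturation B)) = matrix_index (replace_columns F (V ** B ** U))"
    using card_cosets_saturation_conj[OF VU sat] card_cosets_vanishing_on[OF M_zero] by simp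
  also have "\<dots> = nat \<bar>det (replace_columns F (V ** B ** U))\<bar>"
    using det abs_det by (intro matrix_index_eq_abs_det) auto
  finally show ?thesis
    by (simp only: abs_det)
qed

section \<open>The polynomial \<open>g\<^sub>X\<close> near \<open>1\<close>\<close>

definition matrix_pencil :: "'a::zero^'n^'m \<Rightarrow> 'a^'n^'m \<Rightarrow> 'a poly^'n^'m" where
  "matrix_pencil X Y = (\<chi> i j. [:X $ i $ j, Y $ i $ j:])"

lemma coeff_linear_poly: "coeff [:x, y:] n = (if n = 0 then x else if n = 1 then y else 0)"
  by (cases n) (simp_all add: coeff_pCons')

lemma matrix_pencil_conj:
  fixes V U X Y :: "'a::comm_ring_1^'n^'n"
  shows "map_matrix (\<lambda>a. [:a:]) V ** matrix_pencil X Y ** map_matrix (\<lambda>a. [:a:]) U =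
    matrix_pencil (V ** X ** U) (V ** Y ** U)"
proof -
  have "coeff ((map_matrix (\<lambda>a. [:a:]) V ** matrix_pencil X Y ** map_matrix (\<lambda>a. [:a:]) U) $ i $ j) n =
      coeff (matrix_pencil (V ** X ** U) (V ** Y ** U) $ i $ j) n" for i j n
    by (simp add: matrix_pencil_def matrix_matrix_mult_def coeff_sum coeff_linear_poly sum_distrib_right
        sum_distrib_left mult_ac if_distrib[of "\<lambda>u. _ * u"] if_distrib[of "\<lambda>u. u * _"] cong: if_cong)
  then show ?thesis
    by (simp add: vec_eq_iff poly_eq_iff)
qed

lemma det_matrix_pencil_conj:
  fixes V U X Y :: "'a::comm_ring_1^'n^'n"
  assumes "V ** U = mat 1"
  shows "det (matrix_pencil (V ** X ** U) (V ** Y ** U)) = det (matrix_pencil X Y)"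
proof -
  have det_const: "det (map_matrix (\<lambda>a. [:a:]) A) = [:det A:]" for A :: "'a^'n^'n"
    by (rule det_map_matrix) (simp_all add: one_pCons)
  have "det U * det V = 1"
    using assms by (metis det_I det_mul mult.commute)
  then have unit: "[:det V:] * [:det U:] = 1"
    by (simp add: one_pCons)
  have "det (matrix_pencil (V ** X ** U) (V ** Y ** U)) = ([:det V:] * [:det U:]) * det (matrix_pencil X Y)"
    unfolding matrix_pencil_conj[symmetric] det_mul det_const by (simp only: ac_simps)
  then show ?thesis
    by (simp only: unit mult_1_left)
qed

lemma pcompose_g_poly:
  "pcompose (g_poly src tgt) [:1, 1:] = det (matrix_pencil (BF_mat src tgt) (BF_mat src tgt - mat 1))"
proof -
  have "pcompose (g_poly src tgt) [:1, 1:] =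
      det (map_matrix (\<lambda>p. pcompose p [:1, 1:]) (\<chi> i j. (if i = j then 1 else 0) - [:0, adj src tgt $ i $ j:]))"
    unfolding g_poly_def by (rule det_map_matrix[symmetric]) (simp_all add: pcompose_1 pcompose_add pcompose_mult)
  also have "map_matrix (\<lambda>p. pcompose p [:1, 1:]) (\<chi> i j. (if i = j then 1 else 0) - [:0, adj src tgt $ i $ j:]) =
      matrix_pencil (BF_mat src tgt) (BF_mat src tgt - mat 1)"
    by (simp add: vec_eq_iff matrix_pencil_def BF_mat_def mat_def pcompose_diff pcompose_pCons pcompose_1
        one_pCons)
  finally show ?thesis .
qed

lemma det_matrix_pencil_zero_rows:
  fixes M :: "'a::comm_ring_1^'n^'n"
  assumes "\<forall>i\<in>F. \<forall>k. M $ i $ k = 0"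
  obtains q where "det (matrix_pencil M (M - mat 1)) = monom ((-1) ^ card F) (card F) * q"
    and "poly q 0 = det (replace_rows F M)"
proof
  define K :: "'a poly^'n^'n" where
    "K = (\<chi> i k. if i \<in> F then [:if i = k then 1 else 0:] else [:M $ i $ k, M $ i $ k - (if i = k then 1 else 0):])"
  have "matrix_pencil M (M - mat 1) = (\<chi> i. (if i \<in> F then [:0, -1:] else 1) *s K $ i)"
    using assms by (auto simp: vec_eq_iff matrix_pencil_def K_def mat_def)
  then have "det (matrix_pencil M (M - mat 1)) = [:0, -1:] ^ card F * det K"
    by (simp add: det_rows_mul prod.If_cases)
  also have "[:0, -1:] ^ card F = monom ((-1 :: 'a) ^ card F) (card F)"
    by (simp add: monom_power flip: monom_Suc monom_0)
  finally show "det (matrix_pencil M (M - mat 1)) = monom ((-1) ^ card F) (card F) * det K" .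
  have "poly (det K) 0 = det (map_matrix (\<lambda>p. poly p 0) K)"
    by (rule det_map_matrix[symmetric]) simp_all
  also have "map_matrix (\<lambda>p. poly p 0) K = replace_rows F M"
    by (simp add: vec_eq_iff K_def replace_rows_def)
  finally show "poly (det K) 0 = det (replace_rows F M)" .
qed

lemma pcompose_power: "pcompose (p ^ n) q = pcompose p q ^ n"
  by (induction n) (simp_all add: pcompose_1 pcompose_mult)

lemma order_pcompose_linear:
  fixes p :: "'a::idom poly"
  shows "order a p = order 0 (pcompose p [:a, 1:])"
proof -
  have shift_back: "pcompose (pcompose p [:a, 1:]) [:-a, 1:] = p"
    by (simp add: pcompose_assoc[symmetric] pcompose_pCons)
  have dvd_iff: "[:-a, 1:] ^ n dvd p \<longleftrightarrow> [:0, 1:] ^ n dvd pcompose p [:a, 1:]" for n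
  proof
    assume "[:-a, 1:] ^ n dvd p"
    then obtain r where "p = [:-a, 1:] ^ n * r" ..
    then have "pcompose p [:a, 1:] = [:0, 1:] ^ n * pcompose r [:a, 1:]"
      by (simp add: pcompose_mult pcompose_power pcompose_pCons)
    then show "[:0, 1:] ^ n dvd pcompose p [:a, 1:]" ..
  next
    assume "[:0, 1:] ^ n dvd pcompose p [:a, 1:]"
    then obtain r where r: "pcompose p [:a, 1:] = [:0, 1:] ^ n * r" ..
    have "p = pcompose ([:0, 1:] ^ n * r) [:-a, 1:]"
      using shift_back by (simp only: r)
    also have "\<dots> = [:-a, 1:] ^ n * pcompose r [:-a, 1:]"
      by (simp add: pcompose_mult pcompose_power pcompose_pCons)
    finally show "[:-a, 1:] ^ n dvd p" ..
  qed
  show ?thesis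
    unfolding order_def minus_zero by (simp only: dvd_iff)
qed

lemma order_1_coeff_shift:
  fixes p q :: "'a::idom poly"
  assumes "p \<noteq> 0" "c \<noteq> 0" and shift: "pcompose p [:1, 1:] = monom c k * q"
  shows "order 1 p = k \<longleftrightarrow> poly q 0 \<noteq> 0"
    and "coeff (pcompose p [:1, 1:]) k = c * poly q 0"
proof -
  have "pcompose p [:1, 1:] \<noteq> 0"
    using assms(1) by (simp add: pcompose_eq_0_iff)
  then have "q \<noteq> 0"
    using shift by auto
  have "order 1 p = order 0 (monom c k * q)"
    using order_pcompose_linear[of 1 p] shift by simp
  also have "\<dots> = k + order 0 q"
    using \<open>q \<noteq> 0\<close> assms(2) by (simp add: order_mult)
  finally show "order 1 p = k \<longleftrightarrow> poly q 0 \<noteq> 0"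
    using order_eq_0_iff[OF \<open>q \<noteq> 0\<close>] by simp
  show "coeff (pcompose p [:1, 1:]) k = c * poly q 0"
    by (simp add: shift coeff_monom_mult poly_0_coeff_0)
qed

lemma poly_g_poly_0: "poly (g_poly src tgt) 0 = 1"
proof -
  have "poly (g_poly src tgt) 0 =
      det (map_matrix (\<lambda>p. poly p 0) (\<chi> i j. (if i = j then 1 else 0) - [:0, adj src tgt $ i $ j:]))"
    unfolding g_poly_def by (rule det_map_matrix[symmetric]) simp_all
  also have "map_matrix (\<lambda>p. poly p 0) (\<chi> i j. (if i = j then 1 else 0) - [:0, adj src tgt $ i $ j:]) = mat 1"
    by (simp add: vec_eq_iff mat_def)
  finally show ?thesis by simp
qed

lemma g_star_adapted:
  fixes src tgt :: "'e::finite \<Rightarrow> 'v::finite" and V U :: "int^'v^'v"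
  assumes VU: "V ** U = mat 1"
    and zero: "\<forall>i\<in>F. \<forall>k. (V ** BF_mat src tgt) $ i $ k = 0"
    and order: "r_X src tgt = card F"
  defines "M \<equiv> V ** BF_mat src tgt ** U"
  shows "det (replace_rows F M) \<noteq> 0" and "\<bar>g_star src tgt\<bar> = \<bar>det (replace_rows F M)\<bar>"
proof -
  have M_zero: "\<forall>i\<in>F. \<forall>k. M $ i $ k = 0"
    using zero by (simp add: M_def matrix_matrix_mult_def[of "V ** _"])
  obtain q where q: "det (matrix_pencil M (M - mat 1)) = monom ((-1) ^ card F) (card F) * q"
    and q0: "poly q 0 = det (replace_rows F M)"
    using det_matrix_pencil_zero_rows[OF M_zero] by blast
  have "V ** (BF_mat src tgt - mat 1) ** U = M - mat 1"
    by (simp add: M_def matrix_diff_ldistrib matrix_diff_rdistrib VU)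
  then have "det (matrix_pencil M (M - mat 1)) = det (matrix_pencil (BF_mat src tgt) (BF_mat src tgt - mat 1))"
    using det_matrix_pencil_conj[OF VU, of "BF_mat src tgt" "BF_mat src tgt - mat 1"]
    unfolding M_def by simp
  then have "pcompose (g_poly src tgt) [:1, 1:] = monom ((-1) ^ card F) (card F) * q"
    by (simp add: pcompose_g_poly q)
  note shift = order_1_coeff_shift[OF _ _ this]
  have "g_poly src tgt \<noteq> 0"
    using poly_g_poly_0[of src tgt] by auto
  then show "det (replace_rows F M) \<noteq> 0"
    using shift(1) order q0 by (simp add: r_X_def)
  show "\<bar>g_star src tgt\<bar> = \<bar>det (replace_rows F M)\<bar>"
    using shift(2) \<open>g_poly src tgt \<noteq> 0\<close> order q0 by (simp add: g_star_def abs_mult)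
qed

section \<open>The main theorem\<close>

lemma L_X_eq_saturation: "L_X src tgt = saturation (BF_mat src tgt)"
  unfolding L_X_def saturation_def BF_Q_def map_matrix_def of_int_vec_def ..

lemma BF_eq_matrix_vector_mult: "BF src tgt = (*v) (BF_mat src tgt)"
  by (simp add: fun_eq_iff BF_def)

lemma tors_BF_mult_card_R:
  fixes src tgt :: "'e::finite \<Rightarrow> 'v::finite"
  assumes "delta src tgt = 0"
  shows "tors_BF src tgt * card_R src tgt = nat \<bar>g_star src tgt\<bar>" and "g_star src tgt \<noteq> 0"
proof -
  obtain V :: "int^'v^'v" and F where V: "invertible V"
    and zero: "\<forall>i\<in>F. \<forall>k. (V ** BF_mat src tgt) $ i $ k = 0"
    and sat: "saturation (BF_mat src tgt) = {x. V *v x \<in> vanishing_on F}"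
    using exists_adapted_basis by blast
  obtain U where VU: "V ** U = mat 1" "U ** V = mat 1"
    using V unfolding invertible_def by blast
  have "r_X src tgt = card F"
    using assms quot_rank_eq_card[OF V sat] by (simp add: delta_def rank_BF_def BF_eq_matrix_vector_mult)
  note g_star = g_star_adapted[OF VU(1) zero this]
  show "tors_BF src tgt * card_R src tgt = nat \<bar>g_star src tgt\<bar>"
    using card_cosets_saturation_tower[of "BF_mat src tgt"] card_cosets_saturation_image[OF VU zero sat g_star(1)]
      g_star(2)
    by (simp add: tors_BF_def card_R_def quot_card_eq_card_cosets BF_eq_matrix_vector_mult
        L_X_eq_saturation saturation_eq_quot_tors)
  show "g_star src tgt \<noteq> 0"
    using g_star by simp
qed

theorem theorem2p11:
  fixes src tgt :: "'e::finite \<Rightarrow> 'v::finite"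
  assumes "strongly_connected src tgt"
    and "delta src tgt = 0"
  shows "of_nat (card_R src tgt) = \<bar>m_X src tgt\<bar>"
proof -
  note index = tors_BF_mult_card_R[OF assms(2)]
  have "nat \<bar>g_star src tgt\<bar> \<noteq> 0"
    using index(2) by simp
  then have "tors_BF src tgt \<noteq> 0"
    using index(1) by (metis mult_zero_left)
  have "\<bar>m_X src tgt\<bar> = of_int \<bar>g_star src tgt\<bar> / of_nat (tors_BF src tgt)"
    by (simp add: m_X_def abs_divide)
  also have "of_int \<bar>g_star src tgt\<bar> = (of_nat (nat \<bar>g_star src tgt\<bar>) :: rat)"
    by simp
  also have "\<dots> = of_nat (tors_BF src tgt) * of_nat (card_R src tgt)"
    by (simp only: index(1)[symmetric] of_nat_mult)
  finally show ?thesis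
    using \<open>tors_BF src tgt \<noteq> 0\<close> by simp
qed

end
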